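(* Let $\alpha,\beta$ be positive real numbers with $-\alpha<-1<1<\beta$. Then the inclusions $$\mathsf{NORM}_{-\alpha}\subset\mathsf{NORM}\supset\mathsf{NORM}_{\beta}$$ are proper, i.e. $\mathsf{NORM}_{-\alpha}\ne\mathsf{NORM}$ and $\mathsf{NORM}_{\beta}\ne\mathsf{NORM}$.
   Context: Let $\mathsf{NORM}$ be the class of all real normed vector spaces. Let $(X,\|\cdot\|)\in\mathsf{NORM}$ and $\varrho\in\mathbb{R}$. For $\vec x,\vec y\in X\setminus\{\vec 0\}$ put $\mathbf{s}=\left\|\frac{\vec x}{\|\vec x\|}+\frac{\vec y}{\|\vec y\|}\right\|$, $\mathbf{d}=\left\|\frac{\vec x}{\|\vec x\|}-\frac{\vec y}{\|\vec y\|}\right\|$, $\mathbf{\Sigma}=\mathbf{s}^2+\mathbf{d}^2$ (which is $>0$), $\mathbf{\Delta}=\mathbf{s}^2-\mathbf{d}^2$, and $\langle\vec x\,|\,\vec y\rangle_\varrho=\|\vec x\|\cdot\|\vec y\|\cdot\frac14\mathbf{\Delta}\cdot\left(\frac14\mathbf{\Sigma}\right)^{\varrho}$; put $\langle\vec x\,|\,\vec y\rangle_\varrho=0$ if $\vec x=\vec 0$ or $\vec y=\vec 0$. The space $(X,\|\cdot\|)$ "has the angle $\angle_\varrho$" if $|\langle\vec x\,|\,\vec y\rangle_\varrho|\le\|\vec x\|\cdot\|\vec y\|$ for all $\vec x,\vec y\in X$, i.e. if the angle $\angle_\varrho(\vec x,\vec y):=\arccos\frac{\langle\vec x|\vec y\rangle_\varrho}{\|\vec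 x\|\|\vec y\|}$ is defined for all $\vec x,\vec y\ne\vec 0$. $\mathsf{NORM}_\varrho$ is the class of all real normed vector spaces that have the angle $\angle_\varrho$. *)

theory Defs
  imports Complex_Main "HOL-Algebra.Module" "HOL-Library.Equipollence"
begin

text \<open>
  HOL cannot quantify existentially over types, so a real normed vector space is a structure with an
  explicit carrier set, i.e. a module over the field of real numbers together with a norm; it is not
  a type of class \<open>real_normed_vector\<close>. The ring multiplication and unit belonging to the
  record \<open>module\<close> play no role.
\<close>

definition real_ring :: "real ring" where
  "real_ring = \<lparr>carrier = UNIV, mult = (*), one = 1, zero = 0, add = (+)\<rparr>"

record 'a normed_space = "(real, 'a) module" +
  vnorm :: "'a \<Rightarrow> real" (\<open>\<parallel>_\<parallel>\<index>\<close>)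

locale normed_vector_space = Module.module real_ring X for X :: "'a normed_space" (structure) +
  assumes vnorm_nonneg: "x \<in> carrier X \<Longrightarrow> 0 \<le> \<parallel>x\<parallel>"
    and vnorm_eq_0_iff: "x \<in> carrier X \<Longrightarrow> \<parallel>x\<parallel> = 0 \<longleftrightarrow> x = \<zero>"
    and vnorm_smult: "x \<in> carrier X \<Longrightarrow> \<parallel>a \<odot> x\<parallel> = \<bar>a\<bar> * \<parallel>x\<parallel>"
    and vnorm_triangle: "x \<in> carrier X \<Longrightarrow> y \<in> carrier X \<Longrightarrow> \<parallel>x \<oplus> y\<parallel> \<le> \<parallel>x\<parallel> + \<parallel>y\<parallel>"

definition unit_vec :: "'a normed_space \<Rightarrow> 'a \<Rightarrow> 'a" where
  "unit_vec X x = (1 / \<parallel>x\<parallel>\<^bsub>X\<^esub>) \<odot>\<^bsub>X\<^esub> x"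

definition s_val :: "'a normed_space \<Rightarrow> 'a \<Rightarrow> 'a \<Rightarrow> real" where
  "s_val X x y = \<parallel>unit_vec X x \<oplus>\<^bsub>X\<^esub> unit_vec X y\<parallel>\<^bsub>X\<^esub>"

definition d_val :: "'a normed_space \<Rightarrow> 'a \<Rightarrow> 'a \<Rightarrow> real" where
  "d_val X x y = \<parallel>unit_vec X x \<ominus>\<^bsub>X\<^esub> unit_vec X y\<parallel>\<^bsub>X\<^esub>"

definition Sigma_val :: "'a normed_space \<Rightarrow> 'a \<Rightarrow> 'a \<Rightarrow> real" where
  "Sigma_val X x y = (s_val X x y)\<^sup>2 + (d_val X x y)\<^sup>2"

definition Delta_val :: "'a normed_space \<Rightarrow> 'a \<Rightarrow> 'a \<Rightarrow> real" where
  "Delta_val X x y = (s_val X x y)\<^sup>2 - (d_val X x y)\<^sup>2"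

definition rho_product :: "'a normed_space \<Rightarrow> real \<Rightarrow> 'a \<Rightarrow> 'a \<Rightarrow> real" where
  "rho_product X \<rho> x y =
    (if x = \<zero>\<^bsub>X\<^esub> \<or> y = \<zero>\<^bsub>X\<^esub> then 0
     else \<parallel>x\<parallel>\<^bsub>X\<^esub> * \<parallel>y\<parallel>\<^bsub>X\<^esub> * (1/4 * Delta_val X x y) * (1/4 * Sigma_val X x y) powr \<rho>)"

definition has_angle :: "'a normed_space \<Rightarrow> real \<Rightarrow> bool" where
  "has_angle X \<rho> \<longleftrightarrow>
    (\<forall>x\<in>carrier X. \<forall>y\<in>carrier X. \<bar>rho_product X \<rho> x y\<bar> \<le> \<parallel>x\<parallel>\<^bsub>X\<^esub> * \<parallel>y\<parallel>\<^bsub>X\<^esub>)"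

text \<open>
  The type \<open>'a\<close> is the universe from which the elements of the spaces are drawn. A nontrivial real
  vector space has at least continuum many elements, so over a smaller universe \<open>NORM\<close> would
  contain only zero spaces.
\<close>

definition NORM :: "'a normed_space set" where
  "NORM = {X. normed_vector_space X}"

definition NORM_rho :: "real \<Rightarrow> 'a normed_space set" where
  "NORM_rho \<rho> = {X \<in> NORM. has_angle X \<rho>}"

lemma real_normed_vector_in_NORM:
  fixes m :: "'a::real_normed_vector \<Rightarrow> 'a \<Rightarrow> 'a"
  shows "\<lparr>carrier = UNIV, mult = m, one = e, zero = 0, add = (+), smult = (*\<^sub>R), vnorm = norm\<rparr> \<in> NORM"
proof -
  have "cring real_ring"
    by (rule cringI)
      (auto simp: real_ring_def algebra_simps intro!: abelian_groupI comm_monoidI exI[of _ "- _"])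
  moreover have "abelian_group \<lparr>carrier = UNIV, mult = m, one = e, zero = 0, add = (+),
      smult = (*\<^sub>R), vnorm = norm\<rparr>"
    by (rule abelian_groupI) (auto simp: algebra_simps intro: exI[of _ "- _"])
  ultimately have "Module.module real_ring \<lparr>carrier = UNIV, mult = m, one = e, zero = 0, add = (+),
      smult = (*\<^sub>R), vnorm = norm\<rparr>"
    by (rule moduleI) (auto simp: real_ring_def algebra_simps)
  then show ?thesis
    by (simp add: NORM_def normed_vector_space_def normed_vector_space_axioms_def norm_triangle_ineq)
qed

end

theory Submission
  imports Defs "HOL-Analysis.Product_Vector"
begin

text \<open>
  Both inclusions fail to be equalities because of one space, the plane with the supremum norm. For
  unit vectors the angle condition reads
  \<open>\<bar>A - B\<bar> * (A + B) powr \<rho> \<le> 1\<close> with \<open>A = s\<^sup>2 / 4\<close> and \<open>B = d\<^sup>2 / 4\<close>; in an inner product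
  space \<open>A + B = 1\<close>, and in the plane with the supremum norm \<open>A + B\<close> deviates from \<open>1\<close> in both directions.
  For \<open>\<bar>\<rho>\<bar> > 1\<close> the bound is violated by small deviations that have the sign of \<open>\<rho>\<close> and are, to first
  order, as large as \<open>1 - \<bar>A - B\<bar>\<close>.

  Inside a flat edge of the unit square, the vectors \<open>(1, a)\<close> and \<open>(1, -a)\<close> have \<open>A = 1\<close> and
  \<open>B = a\<^sup>2\<close>. To first order in \<open>t = a\<^sup>2\<close> the product \<open>(1 - t) * (1 + t) powr \<beta>\<close> is
  \<open>1 + (\<beta> - 1) * t\<close>, which exceeds \<open>1\<close> for \<open>\<beta> > 1\<close>.

  Around the corner \<open>(1, 1)\<close>, the vectors \<open>(1, 1 - 2 * a)\<close> and \<open>(1 - 2 * a, 1)\<close> have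
  \<open>A = (1 - a)\<^sup>2\<close> and \<open>B = a\<^sup>2\<close>. Here \<open>A - B = 1 - 2 * a\<close>, and \<open>A + B\<close> agrees with this to first
  order, so that the product with exponent \<open>- \<alpha>\<close> is \<open>1 + 2 * (\<alpha> - 1) * a\<close> to first order,
  which exceeds \<open>1\<close> for \<open>\<alpha> > 1\<close>.

  The plane has as many elements as the real line, so it has a copy inside every universe that
  contains a copy of the reals.
\<close>

section \<open>Normed spaces carried to another universe\<close>

text \<open>
  The universe \<open>'a\<close> carries no vector space structure, so a space whose vectors form a type is moved
  along an injection \<open>j\<close>.
\<close>

definition transported_space :: "('b::real_vector \<Rightarrow> 'a) \<Rightarrow> ('b \<Rightarrow> real) \<Rightarrow> 'a normed_space" where
  "transported_space j N =
    \<lparr>carrier = range j, mult = undefined, one = undefined, zero = j 0,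
     add = (\<lambda>u v. j (inv_into UNIV j u + inv_into UNIV j v)),
     smult = (\<lambda>r u. j (r *\<^sub>R inv_into UNIV j u)),
     vnorm = (\<lambda>u. N (inv_into UNIV j u))\<rparr>"

lemma transported_space_simps:
  assumes "inj j"
  shows "carrier (transported_space j N) = range j"
    and "\<zero>\<^bsub>transported_space j N\<^esub> = j 0"
    and "j x \<oplus>\<^bsub>transported_space j N\<^esub> j y = j (x + y)"
    and "r \<odot>\<^bsub>transported_space j N\<^esub> j x = j (r *\<^sub>R x)"
    and "\<parallel>j x\<parallel>\<^bsub>transported_space j N\<^esub> = N x"
  using assms by (simp_all add: transported_space_def)

lemma abelian_group_transported_space:
  assumes "inj j"
  shows "abelian_group (transported_space j N)"
proof (rule abelian_groupI)
  fix u assume "u \<in> carrier (transported_space j N)"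
  then obtain x where "u = j x"
    using assms by (auto simp: transported_space_simps)
  then show "\<exists>v\<in>carrier (transported_space j N).
      v \<oplus>\<^bsub>transported_space j N\<^esub> u = \<zero>\<^bsub>transported_space j N\<^esub>"
    using assms by (auto simp: transported_space_simps intro!: exI[of _ "- x"])
qed (use assms in \<open>auto simp: transported_space_simps algebra_simps\<close>)

lemma transported_space_minus:
  assumes "inj j"
  shows "j x \<ominus>\<^bsub>transported_space j N\<^esub> j y = j (x - y)"
proof -
  interpret abelian_group "transported_space j N"
    using assms by (rule abelian_group_transported_space)
  have "\<ominus>\<^bsub>transported_space j N\<^esub> j y = j (- y)"
    by (rule minus_equality) (use assms in \<open>auto simp: transported_space_simps\<close>)
  then show ?thesis
    using assms by (simp add: a_minus_def transported_space_simps)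
qed

lemma cring_real_ring: "cring real_ring"
  by (rule cringI)
    (auto simp: real_ring_def algebra_simps intro!: abelian_groupI comm_monoidI exI[of _ "- _"])

lemma transported_space_in_NORM:
  assumes j: "inj j"
    and nonneg: "\<And>x. 0 \<le> N x"
    and zero: "\<And>x. N x = 0 \<longleftrightarrow> x = 0"
    and scale: "\<And>r x. N (r *\<^sub>R x) = \<bar>r\<bar> * N x"
    and triangle: "\<And>x y. N (x + y) \<le> N x + N y"
  shows "transported_space j N \<in> NORM"
proof -
  have "Module.module real_ring (transported_space j N)"
    using cring_real_ring abelian_group_transported_space[OF j]
    by (rule moduleI) (auto simp: transported_space_simps[OF j] real_ring_def algebra_simps)
  then show ?thesis
    using nonneg zero scale triangle inj_eq[OF j]
    by (auto simp: NORM_def normed_vector_space_def normed_vector_space_axioms_def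
        transported_space_simps[OF j])
qed

text \<open>
  Halving \<open>s\<close> and \<open>d\<close> absorbs the factors \<open>1/4\<close> of the product, so that its value at two unit vectors
  can be read off from the norms of their sum and difference.
\<close>

lemma transported_space_angle_bound:
  assumes j: "inj j"
    and angle: "has_angle (transported_space j N) \<rho>"
    and x: "x \<noteq> 0" "N x = 1"
    and y: "y \<noteq> 0" "N y = 1"
    and sum: "N (x + y) = 2 * p"
    and diff: "N (x - y) = 2 * q"
  shows "\<bar>p\<^sup>2 - q\<^sup>2\<bar> * (p\<^sup>2 + q\<^sup>2) powr \<rho> \<le> 1"
proof -
  let ?X = "transported_space j N"
  have unit: "unit_vec ?X (j x) = j x" "unit_vec ?X (j y) = j y"
    using x y by (simp_all add: unit_vec_def transported_space_simps[OF j])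
  have "s_val ?X (j x) (j y) = 2 * p" "d_val ?X (j x) (j y) = 2 * q"
    by (simp_all add: s_val_def d_val_def unit sum diff transported_space_simps[OF j]
        transported_space_minus[OF j])
  then have vals: "1/4 * Delta_val ?X (j x) (j y) = p\<^sup>2 - q\<^sup>2"
    "1/4 * Sigma_val ?X (j x) (j y) = p\<^sup>2 + q\<^sup>2"
    by (simp_all add: Delta_val_def Sigma_val_def power_mult_distrib)
  have "rho_product ?X \<rho> (j x) (j y) = (p\<^sup>2 - q\<^sup>2) * (p\<^sup>2 + q\<^sup>2) powr \<rho>"
    unfolding rho_product_def vals using x y by (simp add: transported_space_simps[OF j] inj_eq[OF j])
  moreover have "\<bar>rho_product ?X \<rho> (j x) (j y)\<bar> \<le> \<parallel>j x\<parallel>\<^bsub>?X\<^esub> * \<parallel>j y\<parallel>\<^bsub>?X\<^esub>"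
    using angle unfolding has_angle_def transported_space_simps(1)[OF j] by blast
  ultimately show ?thesis
    using x y by (simp add: transported_space_simps[OF j] abs_mult)
qed

section \<open>The plane with the supremum norm\<close>

definition sup_norm :: "real \<times> real \<Rightarrow> real" where
  "sup_norm p = max \<bar>fst p\<bar> \<bar>snd p\<bar>"

lemma sup_plane_in_NORM:
  assumes "inj j"
  shows "transported_space j sup_norm \<in> NORM"
proof (rule transported_space_in_NORM[OF assms])
  fix r :: real and x y :: "real \<times> real"
  show "sup_norm (r *\<^sub>R x) = \<bar>r\<bar> * sup_norm x"
    by (simp add: sup_norm_def abs_mult max_mult_distrib_left)
  show "sup_norm (x + y) \<le> sup_norm x + sup_norm y"
    unfolding sup_norm_def fst_add snd_add by linarith
qed (auto simp: sup_norm_def prod_eq_iff max_def)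

text \<open>
  By convexity of the exponential function, expanding to first order in the exponent gives a lower
  bound. This makes the two first-order computations rigorous with explicit constants.
\<close>

lemma powr_ge_one_plus_ln:
  fixes q r :: real
  assumes "0 < q"
  shows "1 + r * ln q \<le> q powr r"
  using assms exp_ge_add_one_self[of "r * ln q"] by (simp add: powr_def)

lemma sup_plane_not_has_angle_gt_one:
  assumes j: "inj j" and "1 < \<beta>"
  shows "\<not> has_angle (transported_space j sup_norm) \<beta>"
proof
  assume angle: "has_angle (transported_space j sup_norm) \<beta>"
  \<comment> \<open>The contradiction at the end needs \<open>(\<beta> + 1) * a\<^sup>2 < \<beta> - 1\<close>. This choice of \<open>a\<close> gives equality
    with \<open>a\<close> in place of \<open>a\<^sup>2\<close>, and \<open>a\<^sup>2 < a\<close>.\<close>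
  define a where "a = (\<beta> - 1) / (\<beta> + 1)"
  define t where "t = a\<^sup>2"
  have a: "0 < a" "a < 1" "(\<beta> + 1) * a = \<beta> - 1"
    using \<open>1 < \<beta>\<close> by (auto simp: a_def field_simps)
  have t: "0 < t" "t < a"
    using a by (auto simp: t_def power2_eq_square)
  have small: "(\<beta> + 1) * t < \<beta> - 1"
    using t \<open>1 < \<beta>\<close> a(3) by (metis add_pos_pos mult_strict_left_mono less_trans zero_less_one)
  have "ln (1 / (1 + t)) \<le> 1 / (1 + t) - 1"
    using t by (intro ln_le_minus_one) auto
  then have "t / (1 + t) \<le> ln (1 + t)"
    using t by (simp add: ln_div field_simps)
  then have "\<beta> * (t / (1 + t)) \<le> \<beta> * ln (1 + t)"
    using \<open>1 < \<beta>\<close> by (intro mult_left_mono) auto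
  then have lower: "1 + \<beta> * (t / (1 + t)) \<le> (1 + t) powr \<beta>"
    using powr_ge_one_plus_ln[of "1 + t" \<beta>] t by linarith
  have "\<bar>1\<^sup>2 - a\<^sup>2\<bar> * (1\<^sup>2 + a\<^sup>2) powr \<beta> \<le> 1"
    by (rule transported_space_angle_bound[OF j angle, of "(1, a)" "(1, - a)"])
      (use a in \<open>auto simp: sup_norm_def zero_prod_def\<close>)
  then have "(1 - t) * (1 + t) powr \<beta> \<le> 1"
    using a t by (simp add: t_def)
  moreover have "(1 - t) * (1 + \<beta> * (t / (1 + t))) \<le> (1 - t) * (1 + t) powr \<beta>"
    using lower t a by (intro mult_left_mono) auto
  ultimately have "(1 - t) * (1 + \<beta> * (t / (1 + t))) \<le> 1"
    by linarith
  then have "t * (\<beta> - 1) \<le> t * ((\<beta> + 1) * t)"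
    using t by (simp add: field_simps)
  then show False
    using small t by simp
qed

lemma sup_plane_not_has_angle_lt_minus_one:
  assumes j: "inj j" and "1 < \<alpha>"
  shows "\<not> has_angle (transported_space j sup_norm) (- \<alpha>)"
proof
  assume angle: "has_angle (transported_space j sup_norm) (- \<alpha>)"
  \<comment> \<open>The contradiction at the end needs \<open>\<alpha> * ((1 - 2 * a) * (1 - a)) > 1\<close>, for which
    \<open>\<alpha> * (1 - 3 * a) > 1\<close>, that is \<open>3 * \<alpha> * a < \<alpha> - 1\<close>, suffices.\<close>
  define a where "a = (\<alpha> - 1) / (4 * \<alpha>)"
  define w where "w = 2 * a * (1 - a)"
  have a: "0 < a" "a < 1 / 4" "4 * (\<alpha> * a) = \<alpha> - 1"
    using \<open>1 < \<alpha>\<close> by (auto simp: a_def field_simps)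
  have w: "1 - w = (1 - a)\<^sup>2 + a\<^sup>2"
    by (simp add: w_def power2_eq_square algebra_simps)
  have "0 < 1 - w"
    using a by (simp add: w sum_power2_gt_zero_iff)
  have "ln (1 - w) \<le> - w"
    using ln_le_minus_one[OF \<open>0 < 1 - w\<close>] by simp
  then have "\<alpha> * w \<le> - \<alpha> * ln (1 - w)"
    using mult_left_mono[of "ln (1 - w)" "- w" \<alpha>] \<open>1 < \<alpha>\<close> by simp
  then have lower: "1 + \<alpha> * w \<le> (1 - w) powr (- \<alpha>)"
    using powr_ge_one_plus_ln[OF \<open>0 < 1 - w\<close>, of "- \<alpha>"] by linarith
  have "\<bar>(1 - a)\<^sup>2 - a\<^sup>2\<bar> * ((1 - a)\<^sup>2 + a\<^sup>2) powr (- \<alpha>) \<le> 1"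
    by (rule transported_space_angle_bound[OF j angle, of "(1, 1 - 2 * a)" "(1 - 2 * a, 1)"])
      (use a in \<open>auto simp: sup_norm_def zero_prod_def\<close>)
  moreover have "(1 - a)\<^sup>2 - a\<^sup>2 = 1 - 2 * a"
    by (simp add: power2_eq_square algebra_simps)
  ultimately have "(1 - 2 * a) * (1 - w) powr (- \<alpha>) \<le> 1"
    using a by (simp add: w)
  moreover have "(1 - 2 * a) * (1 + \<alpha> * w) \<le> (1 - 2 * a) * (1 - w) powr (- \<alpha>)"
    using lower a by (intro mult_left_mono) auto
  ultimately have "(1 - 2 * a) * (1 + \<alpha> * w) \<le> 1"
    by linarith
  then have "2 * a * (\<alpha> * ((1 - 2 * a) * (1 - a))) \<le> 2 * a * 1"
    by (simp add: w_def algebra_simps)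
  then have "\<alpha> * ((1 - 2 * a) * (1 - a)) \<le> 1"
    using a by simp
  moreover have "\<alpha> * (1 - 3 * a) \<le> \<alpha> * ((1 - 2 * a) * (1 - a))"
    using \<open>1 < \<alpha>\<close> by (intro mult_left_mono) (auto simp: algebra_simps)
  moreover have "1 < \<alpha> * (1 - 3 * a)"
    using a \<open>1 < \<alpha>\<close> by (simp add: algebra_simps)
  ultimately show False
    by linarith
qed

section \<open>The inclusions are proper\<close>

lemma real_plane_embeds:
  assumes "(UNIV :: real set) \<lesssim> (UNIV :: 'a set)"
  obtains j :: "real \<times> real \<Rightarrow> 'a" where "inj j"
proof -
  have "(UNIV :: real set) \<times> (UNIV :: real set) \<approx> (UNIV :: real set)"
    unfolding eqpoll_iff_card_of_ordIso
    by (rule card_of_Times_same_infinite) (rule infinite_UNIV_char_0)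
  then have "(UNIV :: (real \<times> real) set) \<lesssim> (UNIV :: 'a set)"
    using assms lepoll_trans1 by (metis UNIV_Times_UNIV)
  then show thesis
    using that by (auto simp: lepoll_def)
qed

theorem proposition11:
  fixes \<alpha> \<beta> :: real
  assumes "0 < \<alpha>" and "0 < \<beta>" and "- \<alpha> < -1" and "1 < \<beta>"
    and "(UNIV :: real set) \<lesssim> (UNIV :: 'a set)"
  shows "(NORM_rho (- \<alpha>) :: 'a normed_space set) \<subset> NORM
    \<and> (NORM_rho \<beta> :: 'a normed_space set) \<subset> NORM"
proof -
  obtain j :: "real \<times> real \<Rightarrow> 'a" where j: "inj j"
    using real_plane_embeds assms(5) by blast
  have "\<not> has_angle (transported_space j sup_norm) (- \<alpha>)"
    using sup_plane_not_has_angle_lt_minus_one[OF j] assms by simp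
  moreover have "\<not> has_angle (transported_space j sup_norm) \<beta>"
    using sup_plane_not_has_angle_gt_one[OF j] assms by simp
  ultimately show ?thesis
    using sup_plane_in_NORM[OF j] by (auto simp: NORM_rho_def)
qed

end
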